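(* Let $\Gamma\subset \mathrm{PSL}_2(\mathbb{R})$ be a discrete subgroup without parabolic elements such that $\Gamma\backslash\mathbb{H}^2$ is compact, with $m$ cone points of angles $2\pi/\alpha_1,\dots,2\pi/\alpha_m$ ($\alpha_j\ge2$ integers). For $N\ge1$ let $$E_N=\exp\Big[\sum_{j=1}^m\Big(\log\prod_{k=1}^N\big(e^{(2k-1)\pi\sqrt{-1}/\alpha_j}-1\big)\big(e^{-(2k-1)\pi\sqrt{-1}/\alpha_j}-1\big)-\frac{2N}{\alpha_j}\log2\Big)\Big]$$ be the contribution of the elliptic elements of $\Gamma$ to $|R_{\rho_{2N}}(0)|^{-1}$. Then the contribution of elliptic elements to $(\log|R_{\rho_{2N}}(0)|)/(2N)$ converges to zero as $N\to\infty$, that is, $$\frac{1}{2N}\big(-\log E_N\big)\xrightarrow{N\to\infty}0.$$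
   Context: $\mathbb{H}^2$ is the upper half plane, on which $\mathrm{PSL}_2(\mathbb{R})$ acts by linear fractional transformations. $R_{\rho_{2N}}(s)$ is the Ruelle zeta function of the geodesic flow on $M=\Gamma\backslash\mathrm{PSL}_2(\mathbb{R})$ (right multiplication by $\mathrm{diag}(e^{t/2},e^{-t/2})$), i.e. the meromorphic extension of $\prod_{\gamma\ \mathrm{prime}}\det(\mathbf 1-\rho_{2N}(\gamma)e^{-s\ell(\gamma)})$ over prime closed orbits $\gamma$ of period $\ell(\gamma)$, where $\rho_{2N}:\pi_1(M)\to\mathrm{SL}_{2N}(\mathbb{C})$ is the composition of the restriction of the projection $\widetilde{\mathrm{PSL}}_2(\mathbb{R})\to\mathrm{SL}_2(\mathbb{R})$ to $\pi_1(M)$ (the preimage of $\Gamma$ in the universal cover $\widetilde{\mathrm{PSL}}_2(\mathbb{R})$ of $\mathrm{PSL}_2(\mathbb{R})$) with the $2N$-dimensional irreducible representation of $\mathrm{SL}_2(\mathbb{C})$. The number $|R_{\rho_{2N}}(0)|^{-1}$ equals $\exp[\mu(\mathcal D)(-\frac{N}{\pi}\log2)]\cdot E_N$, where $\mu(\mathcal D)$ is the area of $\Gamma\backslash\mathbb{H}^2$; the second factor $E_N$ is what is called the contribution of the elliptic elements. *)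

theory Defs
  imports "HOL-Analysis.Analysis" "HOL-Algebra.Group_Action"
begin

text \<open>The final topology on \<open>q ` topspace X\<close>, i.e. the one making \<^term>\<open>q\<close> a quotient map.\<close>

definition quotient_topology :: "'a topology \<Rightarrow> ('a \<Rightarrow> 'b) \<Rightarrow> 'b topology" where
  "quotient_topology X q =
     topology (\<lambda>U. U \<subseteq> q ` topspace X \<and> openin X {x \<in> topspace X. q x \<in> U})"

lemma openin_quotient_topology:
  "openin (quotient_topology X q) U \<longleftrightarrow>
     U \<subseteq> q ` topspace X \<and> openin X {x \<in> topspace X. q x \<in> U}"
proof -
  have "istopology (\<lambda>U. U \<subseteq> q ` topspace X \<and> openin X {x \<in> topspace X. q x \<in> U})"
    unfolding istopology_def
  proof (intro conjI allI impI)
    fix S T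
    assume S: "S \<subseteq> q ` topspace X \<and> openin X {x \<in> topspace X. q x \<in> S}"
      and T: "T \<subseteq> q ` topspace X \<and> openin X {x \<in> topspace X. q x \<in> T}"
    show "S \<inter> T \<subseteq> q ` topspace X" using S by blast
    have "{x \<in> topspace X. q x \<in> S \<inter> T} =
        {x \<in> topspace X. q x \<in> S} \<inter> {x \<in> topspace X. q x \<in> T}" by blast
    then show "openin X {x \<in> topspace X. q x \<in> S \<inter> T}" using S T by (simp add: openin_Int)
  next
    fix \<K>
    assume K: "\<forall>K\<in>\<K>. K \<subseteq> q ` topspace X \<and> openin X {x \<in> topspace X. q x \<in> K}"
    show "\<Union>\<K> \<subseteq> q ` topspace X" using K by blast
    have "{x \<in> topspace X. q x \<in> \<Union>\<K>} = (\<Union>K\<in>\<K>. {x \<in> topspace X. q x \<in> K})" by blast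
    then show "openin X {x \<in> topspace X. q x \<in> \<Union>\<K>}" using K by (auto intro!: openin_Union)
  qed
  then show ?thesis
    unfolding quotient_topology_def by (simp add: topology_inverse')
qed

lemma topspace_quotient_topology: "topspace (quotient_topology X q) = q ` topspace X"
proof
  show "topspace (quotient_topology X q) \<subseteq> q ` topspace X"
    using openin_quotient_topology[of X q] openin_topspace by metis
  have "{x \<in> topspace X. q x \<in> q ` topspace X} = topspace X" by blast
  then have "openin (quotient_topology X q) (q ` topspace X)"
    by (simp add: openin_quotient_topology)
  then show "q ` topspace X \<subseteq> topspace (quotient_topology X q)"
    by (rule openin_subset)
qed

lemma quotient_map_quotient_topology: "quotient_map X (quotient_topology X q) q"
  unfolding quotient_map_def topspace_quotient_topology openin_quotient_topology by blast

definition SL2R :: "(real^2^2) monoid" where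
  "SL2R = \<lparr>carrier = {A. det A = 1}, mult = (**), one = mat 1\<rparr>"

definition PSL2R :: "(real^2^2) set monoid" where
  "PSL2R = SL2R Mod {mat 1, - mat 1}"

definition PSL2R_topology :: "(real^2^2) set topology" where
  "PSL2R_topology =
     quotient_topology (top_of_set (carrier SL2R)) (\<lambda>A. {mat 1, - mat 1} #>\<^bsub>SL2R\<^esub> A)"

definition discrete_subgroup :: "(real^2^2) set set \<Rightarrow> bool" where
  "discrete_subgroup \<Gamma> \<longleftrightarrow>
     subgroup \<Gamma> PSL2R \<and> subtopology PSL2R_topology \<Gamma> = discrete_topology \<Gamma>"

definition parabolic :: "(real^2^2) set \<Rightarrow> bool" where
  "parabolic g \<longleftrightarrow> g \<in> carrier PSL2R \<and> g \<noteq> \<one>\<^bsub>PSL2R\<^esub> \<and> (\<exists>A\<in>g. \<bar>trace A\<bar> = 2)"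

definition upper_half_plane :: "complex set" where
  "upper_half_plane = {z. Im z > 0}"

definition SL2_act :: "real^2^2 \<Rightarrow> complex \<Rightarrow> complex" where
  "SL2_act A = moebius (of_real (A$1$1)) (of_real (A$1$2)) (of_real (A$2$1)) (of_real (A$2$2))"

text \<open>The two representatives \<open>\<plusminus>A\<close> of an element of \<^term>\<open>PSL2R\<close> act in the same way,
  so the choice is immaterial (lemma \<open>PSL2_act_coset\<close> below). The restriction to the half-plane is
  what \<^term>\<open>group_action\<close> asks for.\<close>

definition PSL2_act :: "(real^2^2) set \<Rightarrow> complex \<Rightarrow> complex" where
  "PSL2_act g = (\<lambda>z\<in>upper_half_plane. SL2_act (SOME A. A \<in> g) z)"

abbreviation subgroup_of_PSL2R :: "(real^2^2) set set \<Rightarrow> (real^2^2) set monoid" where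
  "subgroup_of_PSL2R \<Gamma> \<equiv> PSL2R\<lparr>carrier := \<Gamma>\<rparr>"

definition quotient_surface :: "(real^2^2) set set \<Rightarrow> complex set topology" where
  "quotient_surface \<Gamma> =
     quotient_topology (top_of_set upper_half_plane) (orbit (subgroup_of_PSL2R \<Gamma>) PSL2_act)"

text \<open>The stabilizer of a point in a discrete \<open>\<Gamma>\<close> is a finite cyclic group, generated by the
  rotation through \<open>2\<pi>\<close> divided by its order; this is the total angle of the quotient metric
  at the image of the point.\<close>

definition cone_angle :: "(real^2^2) set set \<Rightarrow> complex \<Rightarrow> real" where
  "cone_angle \<Gamma> z = 2 * pi / real (card (stabilizer (subgroup_of_PSL2R \<Gamma>) PSL2_act z))"

definition cone_points :: "(real^2^2) set set \<Rightarrow> complex set set" where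
  "cone_points \<Gamma> =
     {p \<in> orbits (subgroup_of_PSL2R \<Gamma>) upper_half_plane PSL2_act.
        \<forall>z\<in>p. stabilizer (subgroup_of_PSL2R \<Gamma>) PSL2_act z \<noteq> {\<one>\<^bsub>PSL2R\<^esub>}}"

definition has_cone_points :: "(real^2^2) set set \<Rightarrow> nat \<Rightarrow> (nat \<Rightarrow> nat) \<Rightarrow> bool" where
  "has_cone_points \<Gamma> m \<alpha> \<longleftrightarrow>
     (\<exists>p. bij_betw p {1..m} (cone_points \<Gamma>) \<and>
        (\<forall>j\<in>{1..m}. \<forall>z\<in>p j. cone_angle \<Gamma> z = 2 * pi / real (\<alpha> j)))"

text \<open>For a group with cone points of angles \<open>2\<pi>/\<alpha> 1, \<dots>, 2\<pi>/\<alpha> m\<close>, the factor of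
  \<open>\<bar>R(0)\<bar>\<close> to the power \<open>-1\<close> that is due to the elliptic elements, \<open>R\<close> being the Ruelle zeta
  function of the \<open>2N\<close>-dimensional representation; the other factor is
  \<open>exp (- area * N * ln 2 / pi)\<close>. The product under the logarithm is a positive real number
  (lemma \<open>elliptic_product_pos\<close> below), so \<^const>\<open>Re\<close> only changes its type.\<close>

definition elliptic_product :: "nat \<Rightarrow> nat \<Rightarrow> complex" where
  "elliptic_product a N =
     (\<Prod>k=1..N. (exp (of_nat (2*k - 1) * of_real pi * \<i> / of_nat a) - 1) *
                (exp (- (of_nat (2*k - 1) * of_real pi * \<i> / of_nat a)) - 1))"

definition elliptic_contribution :: "nat \<Rightarrow> (nat \<Rightarrow> nat) \<Rightarrow> nat \<Rightarrow> real" where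
  "elliptic_contribution m \<alpha> N =
     exp (\<Sum>j=1..m. (ln (Re (elliptic_product (\<alpha> j) N)) - 2 * real N / real (\<alpha> j) * ln 2))"

lemma elliptic_product_pos:
  assumes "a \<ge> 1"
  shows "elliptic_product a N \<in> \<real>" "Re (elliptic_product a N) > 0"
proof -
  have fac: "\<exists>r>0. (exp (of_nat (2*k - 1) * of_real pi * \<i> / of_nat a) - 1) *
      (exp (- (of_nat (2*k - 1) * of_real pi * \<i> / of_nat a)) - 1) = complex_of_real r"
    if k: "k \<ge> 1" for k
  proof -
    define w where "w = of_nat (2*k - 1) * of_real pi * \<i> / complex_of_nat a"
    have cnj: "cnj w = - w" by (simp add: w_def)
    have "exp w \<noteq> 1"
    proof
      assume "exp w = 1"
      then obtain n :: int where n: "Im w = of_int (2 * n) * pi"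
        by (auto simp: exp_eq_1)
      have "Im w = real (2*k - 1) * pi / real a"
        by (simp add: w_def Im_divide_of_nat)
      with n have "real (2*k - 1) = of_int (2 * n) * real a"
        using assms by (simp add: field_simps)
      then have "real_of_int (int (2*k - 1)) = of_int (2 * n * int a)" by simp
      then have "int (2*k - 1) = 2 * n * int a" by (simp only: of_int_eq_iff)
      then have "even (int (2*k - 1))" by simp
      with k show False by simp
    qed
    then have "norm (exp w - 1) > 0" by simp
    moreover have "(exp w - 1) * (exp (- w) - 1) = complex_of_real ((norm (exp w - 1))\<^sup>2)"
      unfolding complex_norm_square by (simp add: exp_cnj cnj flip: exp_minus)
    ultimately show ?thesis
      unfolding w_def by (metis zero_less_power)
  qed
  have "\<exists>r>0. elliptic_product a N = complex_of_real r"
  proof (induction N)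
    case 0
    show ?case by (intro exI[of _ 1]) (simp add: elliptic_product_def)
  next
    case (Suc N)
    then obtain r where r: "r > 0" "elliptic_product a N = complex_of_real r" by blast
    obtain s where s: "s > 0" "(exp (of_nat (2*Suc N - 1) * of_real pi * \<i> / of_nat a) - 1) *
      (exp (- (of_nat (2*Suc N - 1) * of_real pi * \<i> / of_nat a)) - 1) = complex_of_real s"
      using fac[of "Suc N"] by auto
    have "elliptic_product a (Suc N) = elliptic_product a N *
       ((exp (of_nat (2*Suc N - 1) * of_real pi * \<i> / of_nat a) - 1) *
      (exp (- (of_nat (2*Suc N - 1) * of_real pi * \<i> / of_nat a)) - 1))"
      by (simp add: elliptic_product_def)
    then have "elliptic_product a (Suc N) = complex_of_real (r * s)"
      unfolding s(2) r(2) by simp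
    with r(1) s(1) show ?case by (metis mult_pos_pos)
  qed
  then show "elliptic_product a N \<in> \<real>" "Re (elliptic_product a N) > 0" by auto
qed

lemma SL2R_group: "group SL2R"
proof (rule groupI)
  fix A assume "A \<in> carrier SL2R"
  then have d: "det A = 1" by (simp add: SL2R_def)
  then have "invertible A" by (simp add: invertible_det_nz)
  then obtain B where inv: "B ** A = mat 1" by (auto simp: invertible_def)
  then have "det B * det A = 1" by (metis det_I det_mul)
  with d inv show "\<exists>B\<in>carrier SL2R. B \<otimes>\<^bsub>SL2R\<^esub> A = \<one>\<^bsub>SL2R\<^esub>"
    by (auto simp: SL2R_def)
qed (auto simp: SL2R_def det_mul matrix_mul_assoc)

lemma coset_eq: "{mat 1, - mat 1} #>\<^bsub>SL2R\<^esub> A = {A, - A}"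
proof -
  have "(- mat 1) ** A = - A"
    by (simp add: vec_eq_iff matrix_matrix_mult_def mat_def forall_2 sum_2)
  then show ?thesis by (auto simp: r_coset_def SL2R_def)
qed

lemma centre_normal: "{mat 1, - mat 1} \<lhd> SL2R"
proof -
  interpret group SL2R by (rule SL2R_group)
  have neg: "(- mat 1) ** A = - A" "A ** (- mat 1) = - A" for A :: "real^2^2"
    by (simp_all add: vec_eq_iff matrix_matrix_mult_def mat_def forall_2 sum_2)
  have det: "det (- mat 1 :: real^2^2) = 1" by (simp add: det_2 mat_def)
  have "subgroup {mat 1, - mat 1} SL2R"
  proof (rule subgroupI)
    fix a assume a: "a \<in> {mat 1, - mat 1 :: real^2^2}"
    then have "a \<otimes>\<^bsub>SL2R\<^esub> a = \<one>\<^bsub>SL2R\<^esub>" "a \<in> carrier SL2R"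
      by (auto simp: SL2R_def neg det)
    then have "inv\<^bsub>SL2R\<^esub> a = a" by (simp add: inv_equality)
    with a show "inv\<^bsub>SL2R\<^esub> a \<in> {mat 1, - mat 1}" by simp
  qed (auto simp: SL2R_def neg det)
  moreover have "{mat 1, - mat 1} #>\<^bsub>SL2R\<^esub> A = A <#\<^bsub>SL2R\<^esub> {mat 1, - mat 1}" for A
    unfolding coset_eq by (auto simp: l_coset_def SL2R_def neg)
  ultimately show ?thesis by (simp add: normal_def normal_axioms_def SL2R_group)
qed

lemma PSL2R_group: "group PSL2R"
  unfolding PSL2R_def by (rule normal.factorgroup_is_group[OF centre_normal])

lemma carrier_PSL2R: "carrier PSL2R = {{A, - A} |A. det A = 1}"
  by (auto simp: PSL2R_def FactGroup_def RCOSETS_def coset_eq) (auto simp: SL2R_def)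

lemma SL2_act_uminus: "SL2_act (- A) z = SL2_act A z"
proof -
  have "(- x) / (- y) = x / y" for x y :: complex by simp
  from this[of "of_real (A$1$1) * z + of_real (A$1$2)" "of_real (A$2$1) * z + of_real (A$2$2)"]
  show ?thesis by (simp add: SL2_act_def moebius_def)
qed

lemma PSL2_act_coset:
  assumes "z \<in> upper_half_plane"
  shows "PSL2_act {A, - A} z = SL2_act A z"
proof -
  have "(SOME B. B \<in> {A, - A}) \<in> {A, - A}" by (rule someI[of _ A]) simp
  then have "SL2_act (SOME B. B \<in> {A, - A}) z = SL2_act A z"
    using SL2_act_uminus by auto
  with assms show ?thesis by (simp add: PSL2_act_def)
qed

lemma SL2_denom_nonzero:
  fixes A :: "real^2^2"
  assumes "det A = 1" and "Im z > 0"
  shows "of_real (A$2$1) * z + of_real (A$2$2) \<noteq> (0::complex)"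
proof
  assume 0: "of_real (A$2$1) * z + of_real (A$2$2) = (0::complex)"
  then have "A$2$1 * Im z = 0" by (auto simp: complex_eq_iff)
  with assms(2) have "A$2$1 = 0" by simp
  moreover from this 0 have "A$2$2 = 0" by simp
  ultimately show False using assms(1) by (simp add: det_2)
qed

lemma SL2_act_in_upper_half_plane:
  assumes "det A = 1" and "z \<in> upper_half_plane"
  shows "SL2_act A z \<in> upper_half_plane"
proof -
  define n where "n = of_real (A$1$1) * z + complex_of_real (A$1$2)"
  define d where "d = of_real (A$2$1) * z + complex_of_real (A$2$2)"
  have "d \<noteq> 0"
    using SL2_denom_nonzero assms by (simp add: upper_half_plane_def d_def)
  have "Im (n * cnj d) = Im z * det A"
    by (simp add: n_def d_def det_2 algebra_simps)
  moreover have "n / d = n * cnj d / of_real ((norm d)\<^sup>2)"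
    using complex_div_cnj[of n d] by simp
  ultimately have "Im (n / d) = Im z / (norm d)\<^sup>2"
    using assms(1) by (simp only: Im_divide_of_real mult_1_right)
  with \<open>d \<noteq> 0\<close> assms(2) show ?thesis
    by (simp add: upper_half_plane_def SL2_act_def moebius_def n_def d_def)
qed

lemma SL2_act_mult:
  assumes "det A = 1" "det B = 1" "z \<in> upper_half_plane"
  shows "SL2_act (A ** B) z = SL2_act A (SL2_act B z)"
proof -
  define n where "n = of_real (B$1$1) * z + complex_of_real (B$1$2)"
  define d where "d = of_real (B$2$1) * z + complex_of_real (B$2$2)"
  have d: "d \<noteq> 0"
    using SL2_denom_nonzero assms by (simp add: upper_half_plane_def d_def)
  have "SL2_act A (SL2_act B z) = SL2_act A (n / d)"
    by (simp add: SL2_act_def moebius_def n_def d_def)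
  also have "\<dots> = ((of_real (A$1$1) * n + of_real (A$1$2) * d) / d)
      / ((of_real (A$2$1) * n + of_real (A$2$2) * d) / d)"
    using d by (simp add: SL2_act_def moebius_def add_divide_distrib)
  also have "\<dots> = (of_real (A$1$1) * n + of_real (A$1$2) * d)
      / (of_real (A$2$1) * n + of_real (A$2$2) * d)"
    using d by simp
  also have "\<dots> = SL2_act (A ** B) z"
    by (simp add: SL2_act_def moebius_def n_def d_def matrix_matrix_mult_def sum_2 algebra_simps)
  finally show ?thesis by simp
qed

lemma PSL2R_mult:
  "{A, - A} \<otimes>\<^bsub>PSL2R\<^esub> {B, - B} = {A ** B, - (A ** B)}" for A B :: "real^2^2"
proof -
  have "(- A) ** B = - (A ** B)" "A ** (- B) = - (A ** B)" "(- A) ** (- B) = A ** B"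
    by (simp_all add: vec_eq_iff matrix_matrix_mult_def forall_2 sum_2)
  then show ?thesis
    by (auto simp: PSL2R_def FactGroup_def set_mult_def SL2R_def)
qed

lemma PSL2_act_group_action: "group_action PSL2R upper_half_plane PSL2_act"
proof -
  have in_H: "PSL2_act g z \<in> upper_half_plane"
    if "g \<in> carrier PSL2R" "z \<in> upper_half_plane" for g z
    using that by (auto simp: carrier_PSL2R PSL2_act_coset SL2_act_in_upper_half_plane)
  have mult: "PSL2_act (g \<otimes>\<^bsub>PSL2R\<^esub> h) z = PSL2_act g (PSL2_act h z)"
    if gh: "g \<in> carrier PSL2R" "h \<in> carrier PSL2R" and z: "z \<in> upper_half_plane" for g h z
  proof -
    obtain A B where "det A = 1" "g = {A, - A}" "det B = 1" "h = {B, - B}"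
      using gh unfolding carrier_PSL2R by blast
    with z show ?thesis
      by (simp add: PSL2R_mult PSL2_act_coset SL2_act_mult SL2_act_in_upper_half_plane)
  qed
  have one: "PSL2_act \<one>\<^bsub>PSL2R\<^esub> z = z" if "z \<in> upper_half_plane" for z
  proof -
    have "\<one>\<^bsub>PSL2R\<^esub> = {mat 1, - mat 1}" by (simp add: PSL2R_def FactGroup_def)
    with that show ?thesis
      by (simp add: PSL2_act_coset) (simp add: SL2_act_def moebius_def mat_def)
  qed
  interpret group PSL2R by (rule PSL2R_group)
  have bij: "PSL2_act g \<in> Bij upper_half_plane" if g: "g \<in> carrier PSL2R" for g
  proof -
    have "bij_betw (PSL2_act g) upper_half_plane upper_half_plane"
      by (rule bij_betw_byWitness[where f' = "PSL2_act (inv\<^bsub>PSL2R\<^esub> g)"])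
        (use g in_H in \<open>auto simp: one simp flip: mult\<close>)
    then show ?thesis by (auto simp: Bij_def PSL2_act_def)
  qed
  have "PSL2_act \<in> hom PSL2R (BijGroup upper_half_plane)"
  proof (rule homI)
    fix g h assume gh: "g \<in> carrier PSL2R" "h \<in> carrier PSL2R"
    have "PSL2_act (g \<otimes>\<^bsub>PSL2R\<^esub> h) = compose upper_half_plane (PSL2_act g) (PSL2_act h)"
    proof (rule ext)
      fix z show "PSL2_act (g \<otimes>\<^bsub>PSL2R\<^esub> h) z
          = compose upper_half_plane (PSL2_act g) (PSL2_act h) z"
        using mult[OF gh, of z] by (cases "z \<in> upper_half_plane")
          (simp_all add: compose_def PSL2_act_def)
    qed
    with gh bij show "PSL2_act (g \<otimes>\<^bsub>PSL2R\<^esub> h) =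
        PSL2_act g \<otimes>\<^bsub>BijGroup upper_half_plane\<^esub> PSL2_act h"
      by (simp add: BijGroup_def)
  qed (use bij in \<open>simp add: BijGroup_def\<close>)
  then show ?thesis
    by (simp add: group_action_def group_hom_def group_hom_axioms_def PSL2R_group group_BijGroup)
qed

end

theory Submission
  imports Defs "HOL-Computational_Algebra.Fundamental_Theorem_Algebra"
begin

text \<open>The factors of the elliptic product are periodic in \<open>k\<close> with period \<open>\<alpha>\<close>, and over one
  period the numbers \<open>e\<^bsup>(2k-1)\<pi>\<i>/\<alpha>\<^esup>\<close> run through the roots of \<open>X\<^sup>\<alpha> + 1\<close>, whose value at \<open>1\<close>
  is \<open>2\<close>. So every period contributes \<open>4\<close> to the product and \<open>2 log 2\<close> to its logarithm, which is
  what the term \<open>(2N/\<alpha>) log 2\<close> subtracts. Hence each summand of \<open>log E\<^sub>N\<close> is periodic in \<open>N\<close>,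
  therefore bounded, and it vanishes after division by \<open>N\<close>.\<close>

text \<open>The monic polynomial \<open>X^n - 1\<close> has only simple roots, so it is the product
  of its linear factors over the \<open>n\<close>-th roots of unity.\<close>

lemma prod_diff_roots_unity:
  fixes x :: complex
  assumes "n > 0"
  shows "(\<Prod>k<n. x - cis (2 * pi * real k / real n)) = x ^ n - 1"
proof -
  define p :: "complex poly" where "p = monom 1 n - 1"
  have p: "poly p z = z ^ n - 1" for z by (simp add: p_def poly_monom)
  have "degree p = n"
    unfolding p_def using assms
    by (subst diff_conv_add_uminus, subst degree_add_eq_left) (auto simp: degree_monom_eq)
  then have "lead_coeff p = 1" using assms by (simp add: p_def)
  \<comment> \<open>A zero of the derivative \<open>n * X^(n-1)\<close> can only be 0, where
    \<open>p\<close> takes the value -1.\<close>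
  moreover have "rsquarefree p"
    unfolding rsquarefree_roots using assms
    by (auto simp: p) (auto simp: p_def pderiv_diff pderiv_monom poly_monom zero_power)
  ultimately have dec: "(\<Prod>z | z ^ n = 1. [:- z, 1:]) = p"
    using complex_poly_decompose_rsquarefree[of p] by (simp add: p)
  have "(\<Prod>k<n. x - cis (2 * pi * real k / real n)) = (\<Prod>z | z ^ n = 1. x - z)"
    by (rule prod.reindex_bij_betw[OF Complex.bij_betw_roots_unity[OF assms]])
  also have "\<dots> = poly (\<Prod>z | z ^ n = 1. [:- z, 1:]) x"
    by (simp add: poly_prod)
  finally show ?thesis by (simp add: dec p)
qed

text \<open>The two factors in \<open>elliptic_product\<close> are complex conjugates, so each pair
  is a squared norm. Counting \<open>k\<close> from 0 turns \<open>2*k - 1\<close> into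
  \<open>2*k + 1\<close>.\<close>

definition elliptic_factor :: "nat \<Rightarrow> nat \<Rightarrow> real" where
  "elliptic_factor a k = (norm (cis (real (2 * k + 1) * pi / real a) - 1))\<^sup>2"

lemma Re_elliptic_product: "Re (elliptic_product a N) = (\<Prod>k<N. elliptic_factor a k)"
proof -
  have fac: "(exp (of_nat (2 * Suc k - 1) * of_real pi * \<i> / of_nat a) - 1) *
      (exp (- (of_nat (2 * Suc k - 1) * of_real pi * \<i> / of_nat a)) - 1)
      = complex_of_real (elliptic_factor a k)" for k
  proof -
    define t where "t = real (2 * k + 1) * pi / real a"
    have "of_nat (2 * Suc k - 1) * of_real pi * \<i> / of_nat a = \<i> * complex_of_real t"
      by (simp add: t_def field_simps)
    then show ?thesis
      unfolding elliptic_factor_def t_def[symmetric] complex_norm_square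
      by (simp add: cis_conv_exp exp_cnj)
  qed
  have "elliptic_product a N = (\<Prod>k<N. complex_of_real (elliptic_factor a k))"
    by (simp only: elliptic_product_def One_nat_def prod.atLeast1_atMost_eq fac[unfolded One_nat_def])
  then show ?thesis by (simp flip: of_real_prod)
qed

lemma elliptic_factor_periodic:
  assumes "a > 0"
  shows "elliptic_factor a (a + k) = elliptic_factor a k"
proof -
  have "real (2 * (a + k) + 1) * pi / real a = real (2 * k + 1) * pi / real a + 2 * pi"
    using assms by (simp add: field_simps)
  then show ?thesis by (simp add: elliptic_factor_def flip: cis_mult)
qed

text \<open>A rotation by \<open>c\<close> reduces the roots of \<open>X^a + 1\<close> to roots of
  unity, so that \<open>X^a - 1\<close> can be evaluated at \<open>cnj c\<close>.\<close>

lemma prod_elliptic_factor_period: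
  assumes "a > 0"
  shows "(\<Prod>k<a. elliptic_factor a k) = 4"
proof -
  define c where "c = cis (pi / real a)"
  have "norm (cis (real (2 * k + 1) * pi / real a) - 1)
      = norm (cnj c - cis (2 * pi * real k / real a))" for k
  proof -
    have "real (2 * k + 1) * pi / real a = pi / real a + 2 * pi * real k / real a"
      by (simp add: algebra_simps flip: add_divide_distrib)
    \<comment> \<open>The factor \<open>- c\<close> comes out because \<open>c * cnj c = 1\<close>;
      having norm 1, it does not affect the norm.\<close>
    then have "cis (real (2 * k + 1) * pi / real a) - 1
        = - c * (cnj c - cis (2 * pi * real k / real a))"
      by (simp add: c_def cis_cnj right_diff_distrib cis_mult)
    then show ?thesis by (simp add: norm_mult c_def)
  qed
  then have "(\<Prod>k<a. elliptic_factor a k)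
      = (norm (\<Prod>k<a. cnj c - cis (2 * pi * real k / real a)))\<^sup>2"
    by (simp add: elliptic_factor_def prod_norm flip: prod_power_distrib)
  also have "\<dots> = (norm (cnj c ^ a - 1))\<^sup>2"
    by (simp only: prod_diff_roots_unity[OF assms])
  also have "cnj c ^ a = - 1"
    using assms by (simp add: c_def cis_cnj Complex.DeMoivre complex_eq_iff)
  finally show ?thesis by simp
qed

lemma Re_elliptic_product_add_period:
  assumes "a > 0"
  shows "Re (elliptic_product a (a + N)) = 4 * Re (elliptic_product a N)"
proof -
  have "(\<Prod>k<a + N. elliptic_factor a k)
      = (\<Prod>k<a. elliptic_factor a k) * (\<Prod>k<N. elliptic_factor a (a + k))"
    by (induction N) (simp_all add: mult_ac)
  then show ?thesis
    by (simp add: Re_elliptic_product elliptic_factor_periodic prod_elliptic_factor_period assms)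
qed

text \<open>Only the values on one period occur, and the sum of their norms bounds each of
  them.\<close>

lemma Bseq_periodic:
  fixes f :: "nat \<Rightarrow> 'a::real_normed_vector"
  assumes "a > 0" and periodic: "\<And>n. f (a + n) = f n"
  shows "Bseq f"
proof -
  have "f (q * a + r) = f r" for q r
    by (induction q) (simp_all add: periodic add.assoc)
  then have f_mod: "f n = f (n mod a)" for n by (metis div_mult_mod_eq)
  show ?thesis
  proof (rule BseqI')
    fix n
    show "norm (f n) \<le> (\<Sum>r<a. norm (f r))"
      unfolding f_mod[of n] using assms(1) by (intro member_le_sum) auto
  qed
qed

lemma Bseq_elliptic_summand:
  assumes "a > 0"
  shows "Bseq (\<lambda>N. ln (Re (elliptic_product a N)) - 2 * real N / real a * ln 2)"
proof (rule Bseq_periodic[OF assms])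
  fix N
  have "ln (4::real) = 2 * ln 2" using ln_realpow[of "2::real" 2] by simp
  \<comment> \<open>Positivity of the product lets the logarithm split off \<open>ln 4\<close>,
    which is exactly the growth of the subtracted term over one period.\<close>
  then have "ln (Re (elliptic_product a (a + N))) = 2 * ln 2 + ln (Re (elliptic_product a N))"
    using assms elliptic_product_pos(2)[of a N]
    by (simp add: Re_elliptic_product_add_period ln_mult)
  then show "ln (Re (elliptic_product a (a + N))) - 2 * real (a + N) / real a * ln 2
      = ln (Re (elliptic_product a N)) - 2 * real N / real a * ln 2"
    using assms by (simp add: field_simps)
qed

theorem lemma3p17:
  fixes \<Gamma> :: "(real^2^2) set set" and m :: nat and \<alpha> :: "nat \<Rightarrow> nat"
  assumes "discrete_subgroup \<Gamma>"
    and "\<And>g. g \<in> \<Gamma> \<Longrightarrow> \<not> parabolic g"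
    and "compact_space (quotient_surface \<Gamma>)"
    and "\<And>j. j \<in> {1..m} \<Longrightarrow> \<alpha> j \<ge> 2"
    and "has_cone_points \<Gamma> m \<alpha>"
  shows "(\<lambda>N. 1 / (2 * real N) * (- ln (elliptic_contribution m \<alpha> N))) \<longlonglongrightarrow> 0"
proof -
  define g where "g j N = ln (Re (elliptic_product (\<alpha> j) N)) - 2 * real N / real (\<alpha> j) * ln 2"
    for j N
  have "(\<lambda>N. inverse (real N) * g j N) \<longlonglongrightarrow> 0" if "j \<in> {1..m}" for j
  proof -
    have "\<alpha> j > 0" using assms(4)[OF that] by simp
    then have "Bseq (g j)" unfolding g_def by (rule Bseq_elliptic_summand)
    \<comment> \<open>A null sequence times a bounded sequence is a null sequence.\<close>
    moreover have "Zfun (\<lambda>N. inverse (real N)) sequentially"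
      using lim_inverse_n[where 'a = real] by (simp add: tendsto_Zfun_iff)
    ultimately show ?thesis
      by (simp add: tendsto_Zfun_iff bounded_bilinear.Zfun_prod_Bfun[OF bounded_bilinear_mult])
  qed
  then have "(\<lambda>N. - (1 / 2) * (\<Sum>j=1..m. inverse (real N) * g j N)) \<longlonglongrightarrow> - (1 / 2) * (\<Sum>j=1..m. 0)"
    by (intro tendsto_intros)
  \<comment> \<open>This also holds at \<open>N = 0\<close>, where both sides are 0 because division
    by zero yields 0.\<close>
  moreover have "1 / (2 * real N) * (- ln (elliptic_contribution m \<alpha> N))
      = - (1 / 2) * (\<Sum>j=1..m. inverse (real N) * g j N)" for N
    by (simp add: elliptic_contribution_def g_def inverse_eq_divide sum_divide_distrib mult.commute)
  ultimately show ?thesis by (simp only: sum.neutral_const mult_zero_right)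
qed

end
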